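(* For any $0<\alpha,\beta<1$ and any positive integer $t$, there are positive integers $k,\ell,s$ such that $\mathrm{Z}_{\alpha,\beta}(G^s(\ell,k))-\mathrm{Z}_{\alpha,\beta}(G^s(\ell,k)/xu_s)\ge t$.
   Context: All graphs are finite and simple. For an edge $e=ab$ of $G$, $G/e$ denotes the contraction, obtained from $G$ by identifying $a$ and $b$ and suppressing any loops or multiple edges that result. For positive integers $\ell,k$, $G(\ell,k)$ is the graph obtained by identifying a degree-1 vertex of the path $P_{k+1}$ on $k+1$ vertices with the central vertex of the star $K_{1,\ell}$; the identified vertex is called $v$ and its neighbor on the path is called $x$. For a positive integer $s$, $G^s(\ell,k)$ is the graph obtained from $G(\ell,k)$ by adding $s$ new vertices $u_1,\dots,u_s$, each adjacent only to $x$. Let $\alpha,\beta$ be the transmission proportion and the transmission threshold, let $G$ be a graph and $B\subseteq V(G)$ a set of initially filled vertices. The transmission forcing process started from $B$ is defined as follows. Put $B_0=B$, $w_0(v)=1$ for $v\in B$ and $w_0(v)=0$ for $v\in V(G)\setminus B$. For $t\ge 1$, given the set $B_{t-1}$ of vertices filled at time $t-1$ and the weights $w_{t-1}$: for each unfilled vertex $u\in V(G)\setminus B_{t-1}$ let $\mathcal V_{t,u}$ be the set of all $v\in B_{t-1}$ such that $u$ is the only neighbor of $v$ in $V(G)\setminus B_{t-1}$ and $v\notin \mathcal V_{r,u'}$ for every $r<t$ and every $u'$ (each vertex transmits weight at most once); when $v\in\mathcal V_{t,u}$ we say $v$ forces $u$, written $v\to u$. Set $w_t(u)=w_{t-1}(u)+\sum_{v\in\mathcal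 V_{t,u}}\alpha\, w_{t-1}(v)$ for $u\in V(G)\setminus B_{t-1}$ and $w_t(u)=w_{t-1}(u)$ for $u\in B_{t-1}$. Then $B_t=B_{t-1}\cup\{u\in V(G)\setminus B_{t-1} : w_t(u)\ge\beta\}$. The set $B$ is an $(\alpha,\beta)$-transmission zero forcing set of $G$ if $B_t=V(G)$ for some $t\ge 0$, and the $(\alpha,\beta)$-transmission zero forcing number $\mathrm{Z}_{\alpha,\beta}(G)$ is the minimum cardinality of such a set. *)

theory Defs
  imports Complex_Main
begin

section \<open>Finite simple graphs and contraction\<close>

type_synonym 'a graph = "'a set \<times> 'a set set"

abbreviation verts :: "'a graph \<Rightarrow> 'a set" where
  "verts G \<equiv> fst G"

abbreviation edges :: "'a graph \<Rightarrow> 'a set set" where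
  "edges G \<equiv> snd G"

definition simple_graph :: "'a graph \<Rightarrow> bool" where
  "simple_graph G \<longleftrightarrow> finite (verts G) \<and> (\<forall>e \<in> edges G. e \<subseteq> verts G \<and> card e = 2)"

definition nbrs :: "'a graph \<Rightarrow> 'a \<Rightarrow> 'a set" where
  "nbrs G v = {u \<in> verts G. {v, u} \<in> edges G}"

text \<open>The vertex obtained by identifying \<open>a\<close> and \<open>b\<close> keeps the name \<open>a\<close>.
  Loops become singletons and are filtered out; parallel edges coincide as sets.\<close>

definition contract :: "'a graph \<Rightarrow> 'a \<Rightarrow> 'a \<Rightarrow> 'a graph" where
  "contract G a b = (let f = (\<lambda>z. if z = b then a else z)
     in (f ` verts G, {f ` e | e. e \<in> edges G \<and> card (f ` e) = 2}))"

section \<open>Transmission forcing\<close>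

text \<open>A state \<open>(F, w, T)\<close> consists of the filled vertices \<open>F\<close>, the weights \<open>w\<close>, and the set
  \<open>T\<close> of vertices that have already transmitted their weight in an earlier round.\<close>

type_synonym 'a tstate = "'a set \<times> ('a \<Rightarrow> real) \<times> 'a set"

definition forcers :: "'a graph \<Rightarrow> 'a set \<Rightarrow> 'a set \<Rightarrow> 'a \<Rightarrow> 'a set" where
  "forcers G F T u = {v \<in> F. nbrs G v \<inter> (verts G - F) = {u} \<and> v \<notin> T}"

definition init_state :: "'a set \<Rightarrow> 'a tstate" where
  "init_state B = (B, \<lambda>v. if v \<in> B then 1 else 0, {})"

fun step :: "real \<Rightarrow> real \<Rightarrow> 'a graph \<Rightarrow> 'a tstate \<Rightarrow> 'a tstate" where
  "step \<alpha> \<beta> G (F, w, T) =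
    (let w' = (\<lambda>u. if u \<in> verts G - F then w u + (\<Sum>v \<in> forcers G F T u. \<alpha> * w v) else w u)
     in (F \<union> {u \<in> verts G - F. w' u \<ge> \<beta>}, w', T \<union> (\<Union>u \<in> verts G - F. forcers G F T u)))"

definition filled :: "real \<Rightarrow> real \<Rightarrow> 'a graph \<Rightarrow> 'a set \<Rightarrow> nat \<Rightarrow> 'a set" where
  "filled \<alpha> \<beta> G B n = fst ((step \<alpha> \<beta> G ^^ n) (init_state B))"

definition transmission_forcing_set :: "real \<Rightarrow> real \<Rightarrow> 'a graph \<Rightarrow> 'a set \<Rightarrow> bool" where
  "transmission_forcing_set \<alpha> \<beta> G B \<longleftrightarrow>
    B \<subseteq> verts G \<and> (\<exists>n. filled \<alpha> \<beta> G B n = verts G)"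

definition tzf_number :: "real \<Rightarrow> real \<Rightarrow> 'a graph \<Rightarrow> nat" where
  "tzf_number \<alpha> \<beta> G = (LEAST m. \<exists>B. transmission_forcing_set \<alpha> \<beta> G B \<and> card B = m)"

text \<open>The minimum defining \<open>tzf_number\<close> is over a nonempty collection.\<close>

lemma transmission_forcing_set_verts: "transmission_forcing_set \<alpha> \<beta> G (verts G)"
  unfolding transmission_forcing_set_def filled_def init_state_def
  by (auto intro: exI[of _ 0])

section \<open>The graphs \<open>G(l,k)\<close> and \<open>G\<^sup>s(l,k)\<close>\<close>

text \<open>\<open>Pth 0, \<dots>, Pth k\<close> is the path on \<open>k + 1\<close> vertices; \<open>Pth 0\<close> is also the centre of the star,
  whose leaves are \<open>Leaf 1, \<dots>, Leaf l\<close>. Thus \<open>v = Pth 0\<close>, \<open>x = Pth 1\<close> and \<open>u\<^sub>j = Pend j\<close>.\<close>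

datatype vertex = Pth nat | Leaf nat | Pend nat

abbreviation x_vertex :: vertex where "x_vertex \<equiv> Pth 1"

definition Glk :: "nat \<Rightarrow> nat \<Rightarrow> vertex graph" where
  "Glk l k = (Pth ` {0..k} \<union> Leaf ` {1..l},
     {{Pth i, Pth (Suc i)} | i. i < k} \<union> {{Pth 0, Leaf j} | j. j \<in> {1..l}})"

definition Gslk :: "nat \<Rightarrow> nat \<Rightarrow> nat \<Rightarrow> vertex graph" where
  "Gslk s l k = (verts (Glk l k) \<union> Pend ` {1..s},
     edges (Glk l k) \<union> {{x_vertex, Pend j} | j. j \<in> {1..s}})"

lemma simple_graph_Glk: "simple_graph (Glk l k)"
  unfolding simple_graph_def Glk_def by (auto simp: card_insert_if)

lemma simple_graph_Gslk: "0 < k \<Longrightarrow> simple_graph (Gslk s l k)"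
  using simple_graph_Glk[of l k]
  unfolding simple_graph_def Gslk_def by (auto simp: card_insert_if Glk_def)

lemma edge_x_Pend: "0 < s \<Longrightarrow> {x_vertex, Pend s} \<in> edges (Gslk s l k)"
  unfolding Gslk_def by force

lemma simple_graph_contract:
  assumes "simple_graph G" shows "simple_graph (contract G a b)"
  using assms unfolding simple_graph_def contract_def Let_def
  by (auto simp: image_iff subset_iff split: if_splits)

end

theory Submission
  imports Defs
begin

text \<open>Let \<open>s\<close> be least with \<open>s \<alpha> \<ge> \<beta>\<close>. The contraction is \<open>G\<^sup>s\<^sup>-\<^sup>1(l,k)\<close>; there the leaves and the
  pendants form a forcing set, because the \<open>s - 1\<close> pendants leave \<open>x\<close> below the threshold until
  \<open>v\<close> has collected \<open>l \<alpha>\<close>, and for \<open>l\<close> large this weight runs through the whole path.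
  In \<open>G\<^sup>s(l,k)\<close>, all but one of the leaves and of the pendants must be filled initially. If all
  \<open>s\<close> pendants are, they fill \<open>x\<close> in the first round, with weight at most \<open>s + 2\<close>; if one is not,
  then \<open>x\<close> must spend its only transmission on it. Either way the path beyond \<open>x\<close> receives bounded
  weight from that side, so every sufficiently long block of consecutive path vertices contains an
  initially filled vertex, and a long path contains many such blocks.\<close>

section \<open>The state of the process, component by component\<close>

definition wt :: "real \<Rightarrow> real \<Rightarrow> 'a graph \<Rightarrow> 'a set \<Rightarrow> nat \<Rightarrow> 'a \<Rightarrow> real" where
  "wt \<alpha> \<beta> G B n = fst (snd ((step \<alpha> \<beta> G ^^ n) (init_state B)))"

definition used :: "real \<Rightarrow> real \<Rightarrow> 'a graph \<Rightarrow> 'a set \<Rightarrow> nat \<Rightarrow> 'a set" where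
  "used \<alpha> \<beta> G B n = snd (snd ((step \<alpha> \<beta> G ^^ n) (init_state B)))"

text \<open>\<open>active ... n u\<close> collects the transmissions to \<open>u\<close> in round
  \<open>n + 1\<close>, since it is computed from the state at time \<open>n\<close>.\<close>

abbreviation active :: "real \<Rightarrow> real \<Rightarrow> 'a graph \<Rightarrow> 'a set \<Rightarrow> nat \<Rightarrow> 'a \<Rightarrow> 'a set" where
  "active \<alpha> \<beta> G B n u \<equiv> forcers G (filled \<alpha> \<beta> G B n) (used \<alpha> \<beta> G B n) u"

lemma state_0:
  "filled \<alpha> \<beta> G B 0 = B" "wt \<alpha> \<beta> G B 0 = (\<lambda>v. if v \<in> B then 1 else 0)" "used \<alpha> \<beta> G B 0 = {}"
  by (simp_all add: filled_def wt_def used_def init_state_def)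

lemma step_components:
  "fst (step \<alpha> \<beta> G S) = fst S \<union> {u \<in> verts G - fst S. fst (snd (step \<alpha> \<beta> G S)) u \<ge> \<beta>}"
  "fst (snd (step \<alpha> \<beta> G S)) = (\<lambda>u. if u \<in> verts G - fst S
     then fst (snd S) u + (\<Sum>v \<in> forcers G (fst S) (snd (snd S)) u. \<alpha> * fst (snd S) v) else fst (snd S) u)"
  "snd (snd (step \<alpha> \<beta> G S)) = snd (snd S) \<union> (\<Union>u \<in> verts G - fst S. forcers G (fst S) (snd (snd S)) u)"
  by (cases S, simp only: step.simps Let_def fst_conv snd_conv)+

lemma filled_Suc:
  "filled \<alpha> \<beta> G B (Suc n) = filled \<alpha> \<beta> G B n \<union>
     {u \<in> verts G - filled \<alpha> \<beta> G B n. wt \<alpha> \<beta> G B (Suc n) u \<ge> \<beta>}"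
  unfolding filled_def wt_def by (simp add: step_components(1) del: step.simps)

lemma wt_Suc:
  "wt \<alpha> \<beta> G B (Suc n) u = (if u \<in> verts G - filled \<alpha> \<beta> G B n
     then wt \<alpha> \<beta> G B n u + (\<Sum>v \<in> active \<alpha> \<beta> G B n u. \<alpha> * wt \<alpha> \<beta> G B n v) else wt \<alpha> \<beta> G B n u)"
  unfolding filled_def wt_def used_def by (simp add: step_components(2) del: step.simps)

lemma used_Suc:
  "used \<alpha> \<beta> G B (Suc n) = used \<alpha> \<beta> G B n \<union> (\<Union>u \<in> verts G - filled \<alpha> \<beta> G B n. active \<alpha> \<beta> G B n u)"
  unfolding filled_def wt_def used_def by (simp add: step_components(3) del: step.simps)

lemma filled_mono: "filled \<alpha> \<beta> G B n \<subseteq> filled \<alpha> \<beta> G B (Suc n)"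
  by (auto simp: filled_Suc)

lemma filled_subset_verts: "B \<subseteq> verts G \<Longrightarrow> filled \<alpha> \<beta> G B n \<subseteq> verts G"
  by (induction n) (auto simp: state_0 filled_Suc)

lemma used_subset_filled: "used \<alpha> \<beta> G B n \<subseteq> filled \<alpha> \<beta> G B n"
  by (induction n) (auto simp: state_0 used_Suc filled_Suc forcers_def)

text \<open>Only vertices filled by time \<open>n\<close> transmit in the following round, so a
  vertex filled in that round still has its transmission available.\<close>

lemma used_Suc_subset_filled: "used \<alpha> \<beta> G B (Suc n) \<subseteq> filled \<alpha> \<beta> G B n"
  using used_subset_filled[of \<alpha> \<beta> G B n] by (auto simp: used_Suc forcers_def)

section \<open>Forts, twins and the forcing number\<close>

text \<open>\<open>W\<close> is a fort: no vertex outside has exactly one neighbour in it. While all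
  of \<open>W\<close> is unfilled, a filled vertex lies outside \<open>W\<close>, and if it touches
  \<open>W\<close> at all it sees at least two unfilled vertices there. Hence no weight ever enters
  \<open>W\<close>.\<close>

lemma fort_never_filled:
  assumes "0 < \<beta>" "W \<inter> B = {}" "W \<subseteq> verts G"
    and fort: "\<And>v u. v \<notin> W \<Longrightarrow> u \<in> W \<Longrightarrow> nbrs G v \<inter> W \<noteq> {u}"
  shows "W \<inter> filled \<alpha> \<beta> G B n = {} \<and> (\<forall>u \<in> W. wt \<alpha> \<beta> G B n u = 0)"
proof (induction n)
  case 0
  then show ?case using assms by (auto simp: state_0)
next
  case (Suc n)
  have no: "active \<alpha> \<beta> G B n u = {}" if "u \<in> W" for u
  proof -
    have False if v: "v \<in> active \<alpha> \<beta> G B n u" for v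
    proof -
      have "nbrs G v \<inter> W = {u}"
        using v Suc \<open>u \<in> W\<close> assms(3) by (auto simp: forcers_def)
      then show False using fort[of v u] v Suc \<open>u \<in> W\<close> by (auto simp: forcers_def)
    qed
    then show ?thesis by blast
  qed
  have "\<forall>u \<in> W. wt \<alpha> \<beta> G B (Suc n) u = 0"
    using Suc by (simp add: wt_Suc no)
  then show ?case using Suc assms(1) by (auto simp: filled_Suc)
qed

lemma nbrs_sym: "simple_graph G \<Longrightarrow> u \<in> nbrs G v \<Longrightarrow> v \<in> nbrs G u"
  by (auto simp: nbrs_def simple_graph_def insert_commute)

text \<open>Two vertices with the same neighbours form a fort, because every other vertex is
  adjacent to both or to neither.\<close>

lemma twins_meet_forcing_set:
  assumes "0 < \<beta>" "simple_graph G" "transmission_forcing_set \<alpha> \<beta> G B" "a \<in> verts G" "b \<in> verts G" "a \<noteq> b"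
    and twins: "nbrs G a = nbrs G b"
  shows "a \<in> B \<or> b \<in> B"
proof (rule ccontr)
  assume no: "\<not> (a \<in> B \<or> b \<in> B)"
  have fort: "nbrs G v \<inter> {a, b} \<noteq> {u}" if "v \<notin> {a, b}" "u \<in> {a, b}" for v u
  proof -
    have "a \<in> nbrs G v \<longleftrightarrow> b \<in> nbrs G v" using nbrs_sym[OF assms(2)] twins by blast
    then show ?thesis using that(2) \<open>a \<noteq> b\<close> by (cases "a \<in> nbrs G v") auto
  qed
  have "{a, b} \<inter> filled \<alpha> \<beta> G B n = {}" for n
    by (rule fort_never_filled[OF assms(1) _ _ fort, THEN conjunct1]) (use no assms(4,5) in blast)+
  then show False using assms(3,4) unfolding transmission_forcing_set_def by blast
qed

lemma card_at_most_one_missing: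
  assumes "finite A" "\<And>a b. a \<in> A \<Longrightarrow> b \<in> A \<Longrightarrow> a \<noteq> b \<Longrightarrow> a \<in> B \<or> b \<in> B"
  shows "card A - 1 \<le> card (B \<inter> A)"
proof -
  have "card (A - B) \<le> 1"
  proof (rule ccontr)
    assume "\<not> card (A - B) \<le> 1"
    then obtain a b where "a \<in> A - B" "b \<in> A - B" "a \<noteq> b"
      using card_le_Suc0_iff_eq[of "A - B"] assms(1) by auto
    then show False using assms(2) by blast
  qed
  moreover have "card A = card (A - B) + card (B \<inter> A)"
    using card_Diff_subset_Int[of A B] assms(1) card_mono[of A "A \<inter> B"] by (simp add: Int_commute)
  ultimately show ?thesis by simp
qed

lemma tzf_number_le: "transmission_forcing_set \<alpha> \<beta> G B \<Longrightarrow> tzf_number \<alpha> \<beta> G \<le> card B"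
  unfolding tzf_number_def by (rule Least_le) blast

lemma tzf_number_ge:
  assumes "\<And>B. transmission_forcing_set \<alpha> \<beta> G B \<Longrightarrow> m \<le> card B"
  shows "m \<le> tzf_number \<alpha> \<beta> G"
proof -
  have "\<exists>B. transmission_forcing_set \<alpha> \<beta> G B \<and> card B = tzf_number \<alpha> \<beta> G"
    unfolding tzf_number_def
    by (rule LeastI_ex) (use transmission_forcing_set_verts in blast)
  then show ?thesis using assms by metis
qed

section \<open>Neighbourhoods in the graph and its contraction\<close>

lemma verts_Gslk: "verts (Gslk s l k) = Pth ` {0..k} \<union> Leaf ` {1..l} \<union> Pend ` {1..s}"
  by (simp add: Gslk_def Glk_def)

lemma edges_Gslk: "edges (Gslk s l k) =
   {{Pth i, Pth (Suc i)} | i. i < k} \<union> {{Pth 0, Leaf j} | j. j \<in> {1..l}} \<union> {{Pth 1, Pend j} | j. j \<in> {1..s}}"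
  by (simp add: Gslk_def Glk_def)

lemma nbrs_Gslk_Leaf: "nbrs (Gslk s l k) (Leaf j) = (if j \<in> {1..l} then {Pth 0} else {})"
  by (auto simp: nbrs_def verts_Gslk edges_Gslk doubleton_eq_iff)

lemma nbrs_Gslk_Pend: "0 < k \<Longrightarrow> nbrs (Gslk s l k) (Pend j) = (if j \<in> {1..s} then {Pth 1} else {})"
  by (auto simp: nbrs_def verts_Gslk edges_Gslk doubleton_eq_iff)

lemma nbrs_Gslk_Pth: "0 < k \<Longrightarrow> i \<le> k \<Longrightarrow> nbrs (Gslk s l k) (Pth i) =
   {Pth j | j. j \<le> k \<and> (j = Suc i \<or> i = Suc j)} \<union> (if i = 0 then Leaf ` {1..l} else {})
     \<union> (if i = 1 then Pend ` {1..s} else {})"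
  by (auto simp: nbrs_def verts_Gslk edges_Gslk doubleton_eq_iff)

lemma edges_Gslk_insert:
  assumes "0 < s"
  shows "edges (Gslk s l k) = insert {Pth 1, Pend s} (edges (Gslk (s - 1) l k))"
proof -
  have "{1..s} = insert s {1..s - 1}" using assms by auto
  then show ?thesis unfolding edges_Gslk by auto
qed

text \<open>The edge from \<open>Pth 1\<close> to \<open>Pend s\<close> becomes a loop and is
  dropped. Every other edge avoids \<open>Pend s\<close> and is fixed by the identification.\<close>

lemma contract_Gslk:
  assumes "0 < k" "0 < s"
  shows "contract (Gslk s l k) (Pth 1) (Pend s) = Gslk (s - 1) l k"
proof (rule prod_eqI)
  let ?f = "\<lambda>z. if z = Pend s then Pth 1 else z"
  show "verts (contract (Gslk s l k) (Pth 1) (Pend s)) = verts (Gslk (s - 1) l k)"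
    using assms by (auto simp: contract_def verts_Gslk image_iff Let_def)
  have fixed: "?f ` e = e \<and> card e = 2" if e: "e \<in> edges (Gslk (s - 1) l k)" for e
  proof
    have "Pend s \<notin> e" using e assms unfolding edges_Gslk by auto
    then have "?f ` e = id ` e" by (intro image_cong) auto
    then show "?f ` e = e" by simp
    show "card e = 2"
      using e simple_graph_Gslk[OF assms(1), of "s - 1" l] by (auto simp: simple_graph_def)
  qed
  have loop: "?f ` {Pth 1, Pend s} = {Pth 1}" by auto
  have "edges (contract (Gslk s l k) (Pth 1) (Pend s))
      = {?f ` e | e. e \<in> edges (Gslk s l k) \<and> card (?f ` e) = 2}"
    by (simp add: contract_def)
  also have "\<dots> = edges (Gslk (s - 1) l k)"
  proof (intro equalityI subsetI)
    fix e' assume "e' \<in> {?f ` e | e. e \<in> edges (Gslk s l k) \<and> card (?f ` e) = 2}"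
    then obtain e where e: "e' = ?f ` e" "e \<in> edges (Gslk s l k)" "card (?f ` e) = 2" by blast
    have "e \<noteq> {Pth 1, Pend s}" using e(3) loop by auto
    then have "e \<in> edges (Gslk (s - 1) l k)" using e(2) edges_Gslk_insert[OF assms(2)] by blast
    then show "e' \<in> edges (Gslk (s - 1) l k)" using fixed e(1) by simp
  next
    fix e assume e: "e \<in> edges (Gslk (s - 1) l k)"
    then have "e \<in> edges (Gslk s l k)" using edges_Gslk_insert[OF assms(2)] by blast
    moreover have "card (?f ` e) = 2" "e = ?f ` e" using fixed[OF e] by simp_all
    ultimately show "e \<in> {?f ` e | e. e \<in> edges (Gslk s l k) \<and> card (?f ` e) = 2}" by blast
  qed
  finally show "edges (contract (Gslk s l k) (Pth 1) (Pend s)) = edges (Gslk (s - 1) l k)" .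
qed

section \<open>Weight flow along the path\<close>

lemma active_subset_nbrs: "B \<subseteq> verts G \<Longrightarrow> active \<alpha> \<beta> G B n u \<subseteq> nbrs G u"
proof
  fix v assume "B \<subseteq> verts G" "v \<in> active \<alpha> \<beta> G B n u"
  then have "v \<in> verts G" "u \<in> nbrs G v"
    using filled_subset_verts[of B G \<alpha> \<beta> n] by (auto simp: forcers_def)
  then show "v \<in> nbrs G u" by (auto simp: nbrs_def insert_commute)
qed

lemma activeD:
  assumes "v \<in> active \<alpha> \<beta> G B n u"
  shows "v \<in> filled \<alpha> \<beta> G B n" "v \<notin> used \<alpha> \<beta> G B n" "u \<in> verts G" "u \<notin> filled \<alpha> \<beta> G B n"
    "v \<in> used \<alpha> \<beta> G B (Suc n)"
    "w \<in> nbrs G v \<Longrightarrow> w \<noteq> u \<Longrightarrow> w \<in> filled \<alpha> \<beta> G B n"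
  using assms by (auto simp: forcers_def used_Suc nbrs_def)

lemma used_mono: "used \<alpha> \<beta> G B n \<subseteq> used \<alpha> \<beta> G B (Suc n)"
  by (auto simp: used_Suc)

text \<open>\<open>R i\<close> and \<open>L i\<close> bound the weight with which the \<open>i\<close>-th path vertex can force its successor and
  its predecessor. A vertex that forces its successor received nothing from it before, so only
  the incoming flow of the same direction matters.\<close>

locale path_flow =
  fixes \<alpha> \<beta> :: real and s l k :: nat and B :: "vertex set" and R L :: "nat \<Rightarrow> real"
  assumes \<alpha>: "0 < \<alpha>" and k: "0 < k" and B: "B \<subseteq> verts (Gslk s l k)"
    and nonneg: "\<And>i. 0 \<le> R i" "\<And>i. 0 \<le> L i"
    and R: "\<And>i. 1 \<le> i \<Longrightarrow> \<alpha> * R i \<le> R (Suc i)"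
    and L: "\<And>i. 2 \<le> i \<Longrightarrow> \<alpha> * L (Suc i) \<le> L i"
    and init: "\<And>i. 2 \<le> i \<Longrightarrow> Pth i \<in> B \<Longrightarrow> 1 \<le> R i \<and> 1 \<le> L i"
    and source: "\<And>n. Pth 1 \<in> active \<alpha> \<beta> (Gslk s l k) B n (Pth 2) \<Longrightarrow> wt \<alpha> \<beta> (Gslk s l k) B n (Pth 1) \<le> R 1"
begin

abbreviation "fl \<equiv> filled \<alpha> \<beta> (Gslk s l k) B"
abbreviation "us \<equiv> used \<alpha> \<beta> (Gslk s l k) B"
abbreviation "w \<equiv> wt \<alpha> \<beta> (Gslk s l k) B"
abbreviation "act \<equiv> active \<alpha> \<beta> (Gslk s l k) B"

text \<open>A budget for the weight received by \<open>Pth (Suc j)\<close> up to time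
  \<open>n\<close>: each of its two path neighbours is charged once, and only after it has
  transmitted.\<close>

definition inflow :: "nat \<Rightarrow> nat \<Rightarrow> real" where
  "inflow n j = (if Pth j \<in> us n then \<alpha> * R j else 0)
     + (if Pth (Suc (Suc j)) \<in> us n then \<alpha> * L (Suc (Suc j)) else 0)"

text \<open>Once both path neighbours of \<open>Pth (Suc j)\<close> are filled it has nobody left to
  force, so the bounds concern only unfilled vertices and filled vertices with a path neighbour not
  yet filled. The indices start at \<open>Pth 2\<close>; the weight of \<open>Pth 1\<close> is
  controlled by \<open>source\<close>.\<close>

definition bounded :: "nat \<Rightarrow> bool" where
  "bounded n \<longleftrightarrow> (\<forall>j. 1 \<le> j \<longrightarrow> Suc j \<le> k \<longrightarrow>
     (Pth (Suc j) \<notin> fl n \<longrightarrow> w n (Pth (Suc j)) \<le> inflow n j) \<and>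
     (Pth (Suc j) \<in> fl n \<longrightarrow> Pth (Suc (Suc j)) \<notin> fl n \<longrightarrow> w n (Pth (Suc j)) \<le> R (Suc j)) \<and>
     (Pth (Suc j) \<in> fl n \<longrightarrow> Pth j \<notin> fl n \<longrightarrow> w n (Pth (Suc j)) \<le> L (Suc j)))"

lemma inflow_step:
  assumes inv: "bounded n" and j: "1 \<le> j" "Suc j \<le> k" and nf: "Pth (Suc j) \<notin> fl n"
  shows "w (Suc n) (Pth (Suc j)) \<le> inflow (Suc n) j"
proof -
  let ?A = "act n (Pth (Suc j))" and ?a = "Pth j" and ?b = "Pth (Suc (Suc j))"
  have sub: "?A \<subseteq> {?a, ?b}"
    using active_subset_nbrs[OF B, of \<alpha> \<beta> n "Pth (Suc j)"] j k by (auto simp: nbrs_Gslk_Pth)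
  have "(\<Sum>v \<in> ?A. \<alpha> * w n v) = (\<Sum>v \<in> {?a, ?b}. if v \<in> ?A then \<alpha> * w n v else 0)"
    using sub by (subst sum.inter_restrict[symmetric]) (auto intro!: sum.cong)
  also have "\<dots> = (if ?a \<in> ?A then \<alpha> * w n ?a else 0) + (if ?b \<in> ?A then \<alpha> * w n ?b else 0)"
    by simp
  finally have sum: "(\<Sum>v \<in> ?A. \<alpha> * w n v) = \<dots>" .
  \<comment> \<open>The bounds in \<open>bounded\<close> begin at \<open>Pth 2\<close>, so a
    transmission from \<open>Pth 1\<close> is covered by \<open>source\<close> instead.\<close>
  have wa: "w n ?a \<le> R j" if "?a \<in> ?A"
  proof (cases "j = 1")
    case True then show ?thesis using source that by (simp add: numeral_2_eq_2)
  next
    case False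
    then obtain i where "j = Suc i" "1 \<le> i" using j by (cases j) auto
    then show ?thesis using inv j nf activeD(1)[OF that] unfolding bounded_def by auto
  qed
  have wb: "w n ?b \<le> L (Suc (Suc j))" if "?b \<in> ?A"
  proof -
    have "?b \<in> verts (Gslk s l k)" using activeD(1)[OF that] filled_subset_verts[OF B] by blast
    then have "Suc (Suc j) \<le> k" by (auto simp: verts_Gslk)
    then show ?thesis using inv j nf activeD(1)[OF that] unfolding bounded_def by auto
  qed
  have "Pth (Suc j) \<in> verts (Gslk s l k)" using j by (auto simp: verts_Gslk)
  then have eq: "w (Suc n) (Pth (Suc j)) = w n (Pth (Suc j)) + (\<Sum>v \<in> ?A. \<alpha> * w n v)"
    using nf by (simp add: wt_Suc)
  have le: "w n (Pth (Suc j)) \<le> inflow n j" using inv j nf unfolding bounded_def by auto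
  \<comment> \<open>A neighbour transmitting now is outside \<open>us n\<close> but inside
    \<open>us (Suc n)\<close>, so the two summands on the left are never both charged.\<close>
  have pa: "(if ?a \<in> us n then \<alpha> * R j else 0) + (if ?a \<in> ?A then \<alpha> * w n ?a else 0)
      \<le> (if ?a \<in> us (Suc n) then \<alpha> * R j else 0)"
    using activeD(2,5)[where v = ?a and u = "Pth (Suc j)" and G = "Gslk s l k" and n = n] wa used_mono[of \<alpha> \<beta> "Gslk s l k" B n] \<alpha> nonneg(1)[of j]
    by auto
  have pb: "(if ?b \<in> us n then \<alpha> * L (Suc (Suc j)) else 0) + (if ?b \<in> ?A then \<alpha> * w n ?b else 0)
      \<le> (if ?b \<in> us (Suc n) then \<alpha> * L (Suc (Suc j)) else 0)"
    using activeD(2,5)[where v = ?b and u = "Pth (Suc j)" and G = "Gslk s l k" and n = n] wb used_mono[of \<alpha> \<beta> "Gslk s l k" B n] \<alpha> nonneg(2)[of "Suc (Suc j)"]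
    by auto
  show ?thesis using eq sum le pa pb unfolding inflow_def by linarith
qed

lemma bounded: "bounded n"
proof (induction n)
  case 0
  have "0 \<le> inflow 0 j" for j by (simp add: inflow_def state_0)
  then show ?case using init unfolding bounded_def by (auto simp: state_0)
next
  case (Suc n)
  show ?case unfolding bounded_def
  proof (intro allI impI conjI)
    fix j assume j: "1 \<le> j" "Suc j \<le> k"
    have mono: "fl n \<subseteq> fl (Suc n)" by (rule filled_mono)
    have us: "us (Suc n) \<subseteq> fl (Suc n)" by (rule used_subset_filled)
    have old: "w (Suc n) (Pth (Suc j)) = w n (Pth (Suc j))" if "Pth (Suc j) \<in> fl n"
      using that by (simp add: wt_Suc)
    {
      assume "Pth (Suc j) \<notin> fl (Suc n)"
      then show "w (Suc n) (Pth (Suc j)) \<le> inflow (Suc n) j"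
        using inflow_step[OF Suc j] mono by blast
    }
    {
      assume a: "Pth (Suc j) \<in> fl (Suc n)" "Pth (Suc (Suc j)) \<notin> fl (Suc n)"
      show "w (Suc n) (Pth (Suc j)) \<le> R (Suc j)"
      proof (cases "Pth (Suc j) \<in> fl n")
        case True
        then show ?thesis using old Suc a j mono unfolding bounded_def by auto
      next
        case False
        \<comment> \<open>The successor is unfilled and so has not transmitted. Only the
          contribution of the predecessor remains, and \<open>R\<close> is assumed to absorb it. The
          case of \<open>L\<close> below is the mirror image.\<close>
        have "inflow (Suc n) j \<le> R (Suc j)"
          using a us R[OF j(1)] nonneg(1)[of "Suc j"] by (auto simp: inflow_def)
        then show ?thesis using inflow_step[OF Suc j False] by linarith
      qed
    }
    {
      assume a: "Pth (Suc j) \<in> fl (Suc n)" "Pth j \<notin> fl (Suc n)"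
      show "w (Suc n) (Pth (Suc j)) \<le> L (Suc j)"
      proof (cases "Pth (Suc j) \<in> fl n")
        case True
        then show ?thesis using old Suc a j mono unfolding bounded_def by auto
      next
        case False
        have "inflow (Suc n) j \<le> L (Suc j)"
          using a us L[of "Suc j"] j nonneg(2)[of "Suc j"] by (auto simp: inflow_def)
        then show ?thesis using inflow_step[OF Suc j False] by linarith
      qed
    }
  qed
qed

text \<open>The budget \<open>inflow\<close> is largest when both neighbours have transmitted, and
  even then it stays below the threshold.\<close>

lemma low_flow_never_filled:
  assumes "1 \<le> j" "Suc j \<le> k" "Pth (Suc j) \<notin> B" "\<alpha> * R j + \<alpha> * L (Suc (Suc j)) < \<beta>"
  shows "Pth (Suc j) \<notin> fl n"
proof (induction n)
  case 0
  then show ?case using assms by (simp add: state_0)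
next
  case (Suc n)
  have "inflow (Suc n) j \<le> \<alpha> * R j + \<alpha> * L (Suc (Suc j))"
    using \<alpha> nonneg by (simp add: inflow_def)
  then show ?case using Suc inflow_step[OF bounded assms(1,2) Suc] assms(4) by (auto simp: filled_Suc)
qed

end

section \<open>The vertex x as a source of bounded weight\<close>

text \<open>The only neighbour of \<open>Pend j\<close> is \<open>Pth 1\<close>. Until
  \<open>Pth 1\<close> transmits, \<open>Pend j\<close> stays unfilled and prevents
  \<open>Pth 2\<close> from being its unique unfilled neighbour; afterwards \<open>Pth 1\<close>
  cannot transmit again.\<close>

lemma x_force_blocked:
  assumes "0 < \<beta>" "0 < k" "B \<subseteq> verts (Gslk s l k)" "j \<in> {1..s}" "Pend j \<notin> B"
  shows "Pth 1 \<notin> active \<alpha> \<beta> (Gslk s l k) B n (Pth 2)"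
proof
  let ?G = "Gslk s l k"
  have v: "Pend j \<in> verts ?G" using assms(4) by (auto simp: verts_Gslk)
  have inv: "Pth 1 \<notin> used \<alpha> \<beta> ?G B n \<longrightarrow>
      Pend j \<notin> filled \<alpha> \<beta> ?G B n \<and> wt \<alpha> \<beta> ?G B n (Pend j) = 0" for n
  proof (induction n)
    case 0
    then show ?case using assms by (simp add: state_0)
  next
    case (Suc n)
    show ?case
    proof
      assume nu: "Pth 1 \<notin> used \<alpha> \<beta> ?G B (Suc n)"
      then have IH: "Pend j \<notin> filled \<alpha> \<beta> ?G B n" "wt \<alpha> \<beta> ?G B n (Pend j) = 0"
        using Suc used_mono[of \<alpha> \<beta> ?G B n] by auto
      have "active \<alpha> \<beta> ?G B n (Pend j) \<subseteq> {Pth 1}"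
        using active_subset_nbrs[OF assms(3), of \<alpha> \<beta> n "Pend j"] assms(2,4) by (simp add: nbrs_Gslk_Pend)
      then have "active \<alpha> \<beta> ?G B n (Pend j) = {}"
        using nu activeD(5)[where v = "Pth 1" and G = ?G and n = n and u = "Pend j"] by blast
      then have "wt \<alpha> \<beta> ?G B (Suc n) (Pend j) = 0" using IH by (simp add: wt_Suc)
      then show "Pend j \<notin> filled \<alpha> \<beta> ?G B (Suc n) \<and> wt \<alpha> \<beta> ?G B (Suc n) (Pend j) = 0"
        using IH assms(1) by (simp add: filled_Suc)
    qed
  qed
  assume a: "Pth 1 \<in> active \<alpha> \<beta> ?G B n (Pth 2)"
  have "Pend j \<in> nbrs ?G (Pth 1)" using assms(2,4) by (auto simp: nbrs_Gslk_Pth)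
  then show False using inv[of n] activeD(2,6)[OF a] by auto
qed

text \<open>If \<open>Pth 1\<close> is not filled initially, all \<open>s\<close> pendants force it
  in the first round, which reaches the threshold. At most two further forcers join them, its path
  neighbours, and each contributes less than 1. A filled vertex keeps its weight from then
  on.\<close>

lemma x_filled_early:
  assumes "0 < \<alpha>" "\<alpha> < 1" "\<beta> \<le> real s * \<alpha>" "0 < k" "B \<subseteq> verts (Gslk s l k)" "Pend ` {1..s} \<subseteq> B"
  shows "Pth 1 \<in> filled \<alpha> \<beta> (Gslk s l k) B (Suc n) \<and> wt \<alpha> \<beta> (Gslk s l k) B (Suc n) (Pth 1) \<le> real s + 2"
proof (induction n)
  let ?G = "Gslk s l k"
  case 0
  show ?case
  proof (cases "Pth 1 \<in> B")
    case True
    then show ?thesis by (simp add: filled_Suc wt_Suc state_0)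
  next
    case False
    let ?A = "active \<alpha> \<beta> ?G B 0 (Pth 1)"
    have x: "Pth 1 \<in> verts ?G" using assms(4) by (auto simp: verts_Gslk)
    have up: "?A \<subseteq> {Pth 0, Pth 2} \<union> Pend ` {1..s}"
      using active_subset_nbrs[OF assms(5), of \<alpha> \<beta> 0 "Pth 1"] assms(4) by (auto simp: nbrs_Gslk_Pth)
    have lo: "Pend ` {1..s} \<subseteq> ?A"
      using assms(4,6) False x by (auto simp: forcers_def nbrs_Gslk_Pend state_0)
    have fin: "finite ?A" by (rule finite_subset[OF up]) simp
    have cs: "card (Pend ` {1..s}) = s" by (simp add: card_image inj_on_def)
    have "card ?A \<le> card ({Pth 0, Pth 2} \<union> Pend ` {1..s})" by (rule card_mono[OF _ up]) simp
    also have "\<dots> \<le> card {Pth 0, Pth 2} + card (Pend ` {1..s})" by (rule card_Un_le)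
    also have "\<dots> = s + 2" using cs by simp
    finally have cu: "card ?A \<le> s + 2" .
    have cl: "s \<le> card ?A" using card_mono[OF fin lo] cs by simp
    have "wt \<alpha> \<beta> ?G B (Suc 0) (Pth 1) = (\<Sum>v \<in> ?A. \<alpha> * wt \<alpha> \<beta> ?G B 0 v)"
      using x False by (simp add: wt_Suc state_0)
    also have "\<dots> = (\<Sum>v \<in> ?A. \<alpha>)" by (rule sum.cong) (auto simp: forcers_def state_0)
    finally have w: "wt \<alpha> \<beta> ?G B (Suc 0) (Pth 1) = real (card ?A) * \<alpha>" by simp
    have "real (card ?A) * \<alpha> \<le> (real s + 2) * 1"
      using cu assms(1,2) by (intro mult_mono) auto
    moreover have "real s * \<alpha> \<le> real (card ?A) * \<alpha>" using cl assms(1) by simp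
    ultimately show ?thesis using w x assms(3) by (auto simp: filled_Suc[of _ _ _ _ 0])
  qed
next
  case (Suc n)
  then show ?case
    by (subst filled_Suc, subst wt_Suc) simp
qed

text \<open>This supplies the assumption \<open>source\<close> of \<open>path_flow\<close>: a
  missing pendant rules the transmission out, and otherwise \<open>Pth 1\<close> was filled early
  with bounded weight.\<close>

lemma x_source_bound:
  assumes "0 < \<alpha>" "\<alpha> < 1" "0 < \<beta>" "\<beta> \<le> real s * \<alpha>" "0 < k" "B \<subseteq> verts (Gslk s l k)"
    and act: "Pth 1 \<in> active \<alpha> \<beta> (Gslk s l k) B n (Pth 2)"
  shows "wt \<alpha> \<beta> (Gslk s l k) B n (Pth 1) \<le> real s + 2"
proof -
  have "Pend ` {1..s} \<subseteq> B" using x_force_blocked[OF assms(3,5,6)] act by blast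
  then show ?thesis
    using x_filled_early[OF assms(1,2,4,5,6)] by (cases n) (auto simp: state_0)
qed

section \<open>Long path blocks and the lower bound\<close>

text \<open>In a block of \<open>2 * d + 1\<close> vertices disjoint from \<open>B\<close>, weight
  entering from either end is at most \<open>s + 2\<close> and shrinks by a factor \<alpha> at each
  step. The middle vertex \<open>Pth (a + d)\<close> thus gets at most
  \<open>2 * (s + 2) * \<alpha> ^ Suc d\<close>, which is below \<beta>.\<close>

lemma path_block_meets_forcing_set:
  assumes "0 < \<alpha>" "\<alpha> < 1" "0 < \<beta>" "\<beta> \<le> real s * \<alpha>" "0 < k"
    and forcing: "transmission_forcing_set \<alpha> \<beta> (Gslk s l k) B"
    and a: "2 \<le> a" "a + 2 * d \<le> k"
    and d: "2 * (real s + 2) * \<alpha> ^ Suc d < \<beta>"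
  shows "\<exists>i \<in> {a..a + 2 * d}. Pth i \<in> B"
proof (rule ccontr)
  assume no: "\<not> ?thesis"
  define M where "M = real s + 2"
  \<comment> \<open>\<open>R\<close> decays from the left end of the block to its middle and
    \<open>L\<close> from the right end to the middle. Elsewhere both equal \<open>M\<close>, which
    dominates every value times \<alpha>, so returning to \<open>M\<close> respects the flow
    inequalities.\<close>
  define R where "R i = (if a \<le> i \<and> i \<le> a + d then M * \<alpha> ^ (Suc i - a) else M)" for i
  define L where "L i = (if a + d \<le> i \<and> i \<le> a + 2 * d then M * \<alpha> ^ (a + 2 * d + 1 - i) else M)" for i
  have M: "1 \<le> M" by (simp add: M_def)
  have B: "B \<subseteq> verts (Gslk s l k)" using forcing by (simp add: transmission_forcing_set_def)
  have pw: "M * \<alpha> ^ i \<le> M" for i using M assms(1,2) by (simp add: mult_left_le power_le_one)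
  have RM: "R i \<le> M" and LM: "L i \<le> M" for i using pw by (auto simp: R_def L_def)
  have nonneg: "0 \<le> R i" "0 \<le> L i" for i using M assms(1) by (auto simp: R_def L_def)
  have shrink: "\<alpha> * y \<le> M" if "0 \<le> y" "y \<le> M" for y
    using that assms(1,2) mult_mono[of \<alpha> 1 y M] by simp
  have Rs: "\<alpha> * R i \<le> R (Suc i)" for i
  proof (cases "a \<le> Suc i \<and> Suc i \<le> a + d")
    case True
    show ?thesis
    proof (cases "a \<le> i")
      case t: True
      then have "Suc (Suc i) - a = Suc (Suc i - a)" by simp
      then show ?thesis using True t by (simp add: R_def)
    next
      case False
      then have "a = Suc i" using True by simp
      then show ?thesis by (simp add: R_def)
    qed
  next
    case False
    then have "R (Suc i) = M" unfolding R_def by (rule if_not_P)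
    then show ?thesis using shrink[OF nonneg(1) RM] by simp
  qed
  have Ls: "\<alpha> * L (Suc i) \<le> L i" for i
  proof (cases "a + d \<le> i \<and> i \<le> a + 2 * d")
    case True
    show ?thesis
    proof (cases "Suc i \<le> a + 2 * d")
      case t: True
      then have "a + 2 * d + 1 - i = Suc (a + 2 * d + 1 - Suc i)" by simp
      then show ?thesis using True t by (simp add: L_def)
    next
      case False
      then have "i = a + 2 * d" using True by simp
      then show ?thesis by (simp add: L_def)
    qed
  next
    case False
    then have "L i = M" unfolding L_def by (rule if_not_P)
    then show ?thesis using shrink[OF nonneg(2) LM] by simp
  qed
  interpret path_flow \<alpha> \<beta> s l k B R L
  proof
    show "1 \<le> R i \<and> 1 \<le> L i" if "Pth i \<in> B" for i
      using no that M by (auto simp: R_def L_def)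
    have "R 1 = M" using a by (simp add: R_def)
    then show "wt \<alpha> \<beta> (Gslk s l k) B n (Pth 1) \<le> R 1"
      if "Pth 1 \<in> active \<alpha> \<beta> (Gslk s l k) B n (Pth 2)" for n
      using x_source_bound[OF assms(1-5) B that] by (simp add: M_def)
  qed (use assms(1,5) B nonneg Rs Ls in auto)
  define j where "j = a + d - 1"
  have j: "1 \<le> j" "Suc j = a + d" using a by (auto simp: j_def)
  \<comment> \<open>For \<open>d = 0\<close> the block is a single vertex, so its two neighbours lie
    outside and carry the full bound \<open>M\<close>.\<close>
  have "R j = M * \<alpha> ^ d"
  proof (cases "d = 0")
    case False
    then have "a \<le> j" "Suc j - a = d" using j by auto
    then show ?thesis using j by (simp add: R_def)
  qed (use j in \<open>simp add: R_def\<close>)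
  moreover have "L (Suc (Suc j)) = M * \<alpha> ^ d"
  proof (cases "d = 0")
    case False
    then have "a + 2 * d + 1 - Suc (a + d) = d" by simp
    then show ?thesis using False j by (simp add: L_def)
  qed (use j in \<open>simp add: L_def\<close>)
  ultimately have "\<alpha> * R j + \<alpha> * L (Suc (Suc j)) < \<beta>" using d by (simp add: M_def algebra_simps)
  moreover have "Suc j \<le> k" "Pth (Suc j) \<notin> B" using j a no by auto
  ultimately have "Pth (Suc j) \<notin> filled \<alpha> \<beta> (Gslk s l k) B n" for n
    using low_flow_never_filled[OF j(1)] by blast
  moreover have "Pth (Suc j) \<in> verts (Gslk s l k)" using \<open>Suc j \<le> k\<close> by (auto simp: verts_Gslk)
  ultimately show False using forcing unfolding transmission_forcing_set_def by blast
qed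

text \<open>The leaves are pairwise twins, as are the pendants, so at most one of each kind is
  missing from \<open>B\<close>. The vertices \<open>Pth 2\<close> to \<open>Pth k\<close> split
  into \<open>m\<close> consecutive blocks of \<open>2 * d + 1\<close> vertices, each meeting
  \<open>B\<close>.\<close>

lemma tzf_number_Gslk_ge:
  assumes "0 < \<alpha>" "\<alpha> < 1" "0 < \<beta>" "\<beta> \<le> real s * \<alpha>"
    and d: "2 * (real s + 2) * \<alpha> ^ Suc d < \<beta>" and k: "k = 1 + m * (2 * d + 1)" "0 < k"
  shows "(l - 1) + (s - 1) + m \<le> tzf_number \<alpha> \<beta> (Gslk s l k)"
proof (rule tzf_number_ge)
  fix B assume forcing: "transmission_forcing_set \<alpha> \<beta> (Gslk s l k) B"
  let ?G = "Gslk s l k"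
  have B: "B \<subseteq> verts ?G" using forcing by (simp add: transmission_forcing_set_def)
  then have finB: "finite B" by (rule finite_subset) (simp add: verts_Gslk)
  have "card (Leaf ` {1..l}) - 1 \<le> card (B \<inter> Leaf ` {1..l})"
  proof (rule card_at_most_one_missing)
    fix a b assume ab: "a \<in> Leaf ` {1..l}" "b \<in> Leaf ` {1..l}" "a \<noteq> b"
    then have "nbrs ?G a = nbrs ?G b" by (auto simp: nbrs_Gslk_Leaf)
    then show "a \<in> B \<or> b \<in> B"
      using ab by (intro twins_meet_forcing_set[OF assms(3) simple_graph_Gslk[OF k(2)] forcing]) (auto simp: verts_Gslk)
  qed simp
  then have 1: "l - 1 \<le> card (B \<inter> Leaf ` {1..l})" by (simp add: card_image inj_on_def)
  have "card (Pend ` {1..s}) - 1 \<le> card (B \<inter> Pend ` {1..s})"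
  proof (rule card_at_most_one_missing)
    fix a b assume ab: "a \<in> Pend ` {1..s}" "b \<in> Pend ` {1..s}" "a \<noteq> b"
    then have "nbrs ?G a = nbrs ?G b" using k(2) by (auto simp: nbrs_Gslk_Pend)
    then show "a \<in> B \<or> b \<in> B"
      using ab by (intro twins_meet_forcing_set[OF assms(3) simple_graph_Gslk[OF k(2)] forcing]) (auto simp: verts_Gslk)
  qed simp
  then have 2: "s - 1 \<le> card (B \<inter> Pend ` {1..s})" by (simp add: card_image inj_on_def)
  \<comment> \<open>The quotient is the number of the block containing \<open>Pth i\<close>. It
    gives a surjection from the path vertices in \<open>B\<close> onto the \<open>m\<close>
    blocks.\<close>
  have "\<exists>i. Pth i \<in> B \<and> (i - 2) div (2 * d + 1) = q" if "q < m" for q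
  proof -
    have "(q + 1) * (2 * d + 1) \<le> m * (2 * d + 1)" using that by (intro mult_right_mono) auto
    then have "2 + q * (2 * d + 1) + 2 * d \<le> k" using k by simp
    then obtain i where i: "i \<in> {2 + q * (2 * d + 1)..2 + q * (2 * d + 1) + 2 * d}" "Pth i \<in> B"
      using path_block_meets_forcing_set[OF assms(1-4) k(2) forcing _ _ d, of "2 + q * (2 * d + 1)"] by auto
    then obtain r where "i = 2 + (q * (2 * d + 1) + r)" "r < 2 * d + 1"
      using le_Suc_ex[of "2 + q * (2 * d + 1)" i] by auto
    then have "(i - 2) div (2 * d + 1) = q" by (intro div_nat_eqI) (simp_all add: algebra_simps)
    then show ?thesis using i by blast
  qed
  then have "{..<m} \<subseteq> (\<lambda>v. case v of Pth i \<Rightarrow> (i - 2) div (2 * d + 1)) ` (B \<inter> range Pth)"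
    by (force simp: image_iff)
  then have 3: "m \<le> card (B \<inter> range Pth)"
    using surj_card_le[of "B \<inter> range Pth" "{..<m}"] finB by simp
  have "card (B \<inter> Leaf ` {1..l}) + card (B \<inter> Pend ` {1..s}) + card (B \<inter> range Pth)
      = card (B \<inter> Leaf ` {1..l} \<union> B \<inter> Pend ` {1..s} \<union> B \<inter> range Pth)"
    using finB by (subst card_Un_disjoint; (subst card_Un_disjoint)?) auto
  also have "\<dots> \<le> card B" using finB by (intro card_mono) auto
  finally show "(l - 1) + (s - 1) + m \<le> card B" using 1 2 3 by linarith
qed

section \<open>Upper bound when the pendants alone do not fill x\<close>

lemma tzf_number_Gslk_le:
  assumes "0 < \<alpha>" "\<alpha> < 1" "0 < \<beta>" "\<beta> < 1" "real s * \<alpha> < \<beta>" "0 < k" and l: "1 \<le> real l * \<alpha> ^ Suc k"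
  shows "tzf_number \<alpha> \<beta> (Gslk s l k) \<le> l + s"
proof -
  let ?G = "Gslk s l k"
  define B where "B = Leaf ` {1..l} \<union> Pend ` {1..s}"
  let ?fl = "filled \<alpha> \<beta> ?G B" and ?w = "wt \<alpha> \<beta> ?G B" and ?us = "used \<alpha> \<beta> ?G B"
  have B: "B \<subseteq> verts ?G" by (auto simp: B_def verts_Gslk)
  have PB: "Pth i \<notin> B" for i by (auto simp: B_def)
  have vG: "verts ?G = B \<union> Pth ` {..k}" by (auto simp: B_def verts_Gslk)
  \<comment> \<open>The weights guaranteed along the path are \<open>real l * \<alpha> ^ i\<close>
    with \<open>i \<le> Suc k\<close>. The last is the smallest, so all of them exceed
    \<beta>.\<close>
  have big: "1 \<le> real l * \<alpha> ^ i" if "i \<le> Suc k" for i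
  proof -
    have "\<alpha> ^ Suc k \<le> \<alpha> ^ i" using that assms(1,2) by (intro power_decreasing) auto
    then show ?thesis using l mult_left_mono[of "\<alpha> ^ Suc k" "\<alpha> ^ i" "real l"] by linarith
  qed
  \<comment> \<open>At time \<open>n + 1\<close> the filled part of the path is exactly
    \<open>Pth 0\<close> to \<open>Pth n\<close>, and its last vertex has not transmitted. The
    exception at \<open>i = 1\<close> is the weight that the pendants leave on \<open>Pth 1\<close>
    in the first round without filling it.\<close>
  have wave: "n \<le> k \<longrightarrow> ?fl (Suc n) = B \<union> Pth ` {..n} \<and> Pth n \<notin> ?us (Suc n) \<and>
      real l * \<alpha> ^ Suc n \<le> ?w (Suc n) (Pth n) \<and>
      (\<forall>i. n < i \<longrightarrow> (if i = 1 then 0 \<le> ?w (Suc n) (Pth i) else ?w (Suc n) (Pth i) = 0))" for n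
  proof (induction n)
    case 0
    have w0: "(\<Sum>v \<in> A. \<alpha> * ?w 0 v) = real (card A) * \<alpha>" if "A \<subseteq> B" for A
    proof -
      have "(\<Sum>v \<in> A. \<alpha> * ?w 0 v) = (\<Sum>v \<in> A. \<alpha>)" using that by (intro sum.cong) (auto simp: state_0)
      then show ?thesis by simp
    qed
    have nb: "active \<alpha> \<beta> ?G B 0 u \<subseteq> B \<inter> nbrs ?G u" for u
      using active_subset_nbrs[OF B, of \<alpha> \<beta> 0 u] by (auto simp: forcers_def state_0)
    have a0: "active \<alpha> \<beta> ?G B 0 (Pth 0) = Leaf ` {1..l}"
    proof
      show "active \<alpha> \<beta> ?G B 0 (Pth 0) \<subseteq> Leaf ` {1..l}"
        using nb[of "Pth 0"] assms(6) by (auto simp: nbrs_Gslk_Pth B_def)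
      show "Leaf ` {1..l} \<subseteq> active \<alpha> \<beta> ?G B 0 (Pth 0)"
        by (auto simp: forcers_def state_0 nbrs_Gslk_Leaf verts_Gslk B_def)
    qed
    have a1: "active \<alpha> \<beta> ?G B 0 (Pth 1) \<subseteq> Pend ` {1..s}"
      using nb[of "Pth 1"] assms(6) by (auto simp: nbrs_Gslk_Pth B_def)
    have a2: "active \<alpha> \<beta> ?G B 0 (Pth i) = {}" if "2 \<le> i" "i \<le> k" for i
      using nb[of "Pth i"] assms(6) that by (auto simp: nbrs_Gslk_Pth B_def)
    have W0: "?w (Suc 0) (Pth 0) = real l * \<alpha>"
    proof -
      have "?w 0 (Pth 0) = 0" by (simp add: state_0 PB)
      moreover have "Pth 0 \<in> verts ?G - ?fl 0" by (auto simp: vG PB state_0)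
      moreover have "(\<Sum>v \<in> Leaf ` {1..l}. \<alpha> * ?w 0 v) = real l * \<alpha>"
        using w0[of "Leaf ` {1..l}"] by (simp add: B_def card_image inj_on_def)
      ultimately show ?thesis by (subst wt_Suc) (simp add: a0)
    qed
    have c1: "card (active \<alpha> \<beta> ?G B 0 (Pth 1)) \<le> s"
      using card_mono[OF _ a1] by (simp add: card_image inj_on_def)
    have W1: "?w (Suc 0) (Pth 1) = real (card (active \<alpha> \<beta> ?G B 0 (Pth 1))) * \<alpha>"
    proof -
      have "active \<alpha> \<beta> ?G B 0 (Pth 1) \<subseteq> B" using nb by blast
      moreover have "?w 0 (Pth 1) = 0" by (simp add: state_0 PB)
      moreover have "Pth 1 \<in> verts ?G - ?fl 0" using assms(6) by (auto simp: vG PB state_0)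
      ultimately show ?thesis using w0 by (subst wt_Suc) simp
    qed
    have W1': "0 \<le> ?w (Suc 0) (Pth 1)" "?w (Suc 0) (Pth 1) < \<beta>"
    proof -
      have "real (card (active \<alpha> \<beta> ?G B 0 (Pth 1))) * \<alpha> \<le> real s * \<alpha>"
        using c1 assms(1) by (intro mult_right_mono) auto
      then show "?w (Suc 0) (Pth 1) < \<beta>" using W1 assms(5) by linarith
      show "0 \<le> ?w (Suc 0) (Pth 1)" using W1 assms(1) by simp
    qed
    have W2: "?w (Suc 0) (Pth i) = 0" if "2 \<le> i" for i
      using a2[OF that] by (auto simp: wt_Suc vG state_0 PB)
    have b0: "\<beta> \<le> ?w (Suc 0) (Pth 0)" using W0 big[of 1] assms(4) by simp
    have "?w (Suc 0) (Pth i) < \<beta>" if "0 < i" for i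
      using W1' W2[of i] that assms(3) by (cases "i = 1") auto
    then have iff: "\<beta> \<le> ?w (Suc 0) (Pth i) \<longleftrightarrow> i = 0" for i
      using b0 by (cases "i = 0") (simp_all add: not_le)
    have F: "?fl (Suc 0) = B \<union> Pth ` {..0}"
      unfolding filled_Suc state_0(1) vG by (auto simp: PB iff)
    have "Pth 0 \<notin> ?us (Suc 0)"
      using used_Suc_subset_filled[of \<alpha> \<beta> ?G B 0] PB by (auto simp: state_0)
    then show ?case using F W0 W1' W2 by auto
  next
    case (Suc n)
    show ?case
    proof (intro impI)
      assume n: "Suc n \<le> k"
      then have IH: "?fl (Suc n) = B \<union> Pth ` {..n}" "Pth n \<notin> ?us (Suc n)"
        "real l * \<alpha> ^ Suc n \<le> ?w (Suc n) (Pth n)"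
        "\<And>i. n < i \<Longrightarrow> if i = 1 then 0 \<le> ?w (Suc n) (Pth i) else ?w (Suc n) (Pth i) = 0"
        using Suc by auto
      \<comment> \<open>Leaves and pendants all spend their transmission in the first round, so
        later only path vertices can force.\<close>
      have usB: "B \<subseteq> ?us (Suc 0)"
      proof
        fix v assume v: "v \<in> B"
        have "v \<in> active \<alpha> \<beta> ?G B 0 (if v \<in> range Leaf then Pth 0 else Pth 1)"
          using v assms(6) PB
          by (auto simp: forcers_def state_0 nbrs_Gslk_Leaf nbrs_Gslk_Pend vG B_def)
        then show "v \<in> ?us (Suc 0)" by (rule activeD(5))
      qed
      have "?us (Suc 0) \<subseteq> ?us (Suc n)" by (rule lift_Suc_mono_le[of ?us]) (auto simp: used_Suc)
      then have usn: "B \<subseteq> ?us (Suc n)" using usB by blast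
      have an: "active \<alpha> \<beta> ?G B (Suc n) (Pth (Suc n)) = {Pth n}"
      proof
        show "active \<alpha> \<beta> ?G B (Suc n) (Pth (Suc n)) \<subseteq> {Pth n}"
        proof
          fix v assume v: "v \<in> active \<alpha> \<beta> ?G B (Suc n) (Pth (Suc n))"
          then have "v \<notin> B" "v \<in> ?fl (Suc n)" using usn activeD(1,2)[OF v] by auto
          then obtain i where "v = Pth i" "i \<le> n" using IH(1) by auto
          then show "v \<in> {Pth n}"
            using subsetD[OF active_subset_nbrs[OF B] v] n assms(6) by (auto simp: nbrs_Gslk_Pth split: if_splits)
        qed
        have "nbrs ?G (Pth n) \<inter> (verts ?G - ?fl (Suc n)) = {Pth (Suc n)}"
          unfolding IH(1) vG using n assms(6) by (auto simp: nbrs_Gslk_Pth PB B_def)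
        then show "{Pth n} \<subseteq> active \<alpha> \<beta> ?G B (Suc n) (Pth (Suc n))"
          using IH(1,2) by (auto simp: forcers_def)
      qed
      have ai: "active \<alpha> \<beta> ?G B (Suc n) (Pth i) = {}" if i: "Suc n < i" "i \<le> k" for i
      proof -
        have False if v: "v \<in> active \<alpha> \<beta> ?G B (Suc n) (Pth i)" for v
        proof -
          have "v \<notin> B" "v \<in> ?fl (Suc n)" using usn activeD(1,2)[OF v] by auto
          then obtain j where "v = Pth j" "j \<le> n" using IH(1) by auto
          then show False
            using subsetD[OF active_subset_nbrs[OF B] v] i assms(6) by (auto simp: nbrs_Gslk_Pth split: if_splits)
        qed
        then show ?thesis by blast
      qed
      have nf: "Pth i \<notin> ?fl (Suc n)" if "n < i" for i using that IH(1) PB by auto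
      have "0 \<le> ?w (Suc n) (Pth (Suc n))" using IH(4)[of "Suc n"] by (auto split: if_splits)
      moreover have "?w (Suc (Suc n)) (Pth (Suc n)) = ?w (Suc n) (Pth (Suc n)) + \<alpha> * ?w (Suc n) (Pth n)"
        using nf[of "Suc n"] n by (subst wt_Suc) (auto simp: an vG)
      moreover have "\<alpha> * (real l * \<alpha> ^ Suc n) \<le> \<alpha> * ?w (Suc n) (Pth n)"
        using IH(3) assms(1) by (intro mult_left_mono) auto
      ultimately have W: "real l * \<alpha> ^ Suc (Suc n) \<le> ?w (Suc (Suc n)) (Pth (Suc n))"
        by (simp add: mult.left_commute)
      have Wi: "?w (Suc (Suc n)) (Pth i) = 0" if "Suc n < i" for i
        using IH(4)[of i] that ai[OF that] by (subst wt_Suc) (auto simp: vG PB)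
      have b1: "\<beta> \<le> ?w (Suc (Suc n)) (Pth (Suc n))" using W big[of "Suc (Suc n)"] n assms(4) by linarith
      have iff: "\<beta> \<le> ?w (Suc (Suc n)) (Pth i) \<longleftrightarrow> i = Suc n" if "n < i" for i
        using b1 Wi[of i] that assms(3) by (cases "i = Suc n") auto
      have F: "?fl (Suc (Suc n)) = B \<union> Pth ` {..Suc n}"
        unfolding filled_Suc[of _ _ _ _ "Suc n"] IH(1) vG using n by (auto simp: PB iff atMost_Suc image_iff)
      have "Pth (Suc n) \<notin> ?us (Suc (Suc n))"
        using used_Suc_subset_filled[of \<alpha> \<beta> ?G B "Suc n"] nf[of "Suc n"] by auto
      then show "?fl (Suc (Suc n)) = B \<union> Pth ` {..Suc n} \<and> Pth (Suc n) \<notin> ?us (Suc (Suc n)) \<and>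
        real l * \<alpha> ^ Suc (Suc n) \<le> ?w (Suc (Suc n)) (Pth (Suc n)) \<and>
        (\<forall>i. Suc n < i \<longrightarrow> (if i = 1 then 0 \<le> ?w (Suc (Suc n)) (Pth i) else ?w (Suc (Suc n)) (Pth i) = 0))"
        using F W Wi by auto
    qed
  qed
  have "?fl (Suc k) = verts ?G" using wave[of k] vG by simp
  then have "transmission_forcing_set \<alpha> \<beta> ?G B" using B unfolding transmission_forcing_set_def by blast
  then have "tzf_number \<alpha> \<beta> ?G \<le> card B" by (rule tzf_number_le)
  also have "card B \<le> card (Leaf ` {1..l}) + card (Pend ` {1..s})" unfolding B_def by (rule card_Un_le)
  also have "\<dots> = l + s" by (simp add: card_image inj_on_def)
  finally show ?thesis .
qed

section \<open>Choice of the parameters\<close>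

theorem corollary5p3p1:
  fixes \<alpha> \<beta> :: real and t :: nat
  assumes "0 < \<alpha>" "\<alpha> < 1" "0 < \<beta>" "\<beta> < 1" "0 < t"
  shows "\<exists>k l s :: nat. 0 < k \<and> 0 < l \<and> 0 < s \<and>
    int (tzf_number \<alpha> \<beta> (Gslk s l k)) - int (tzf_number \<alpha> \<beta> (contract (Gslk s l k) x_vertex (Pend s))) \<ge> int t"
proof -
  define s where "s = (LEAST s. \<beta> \<le> real s * \<alpha>)"
  have ex: "\<exists>s. \<beta> \<le> real s * \<alpha>"
    using reals_Archimedean3[OF assms(1), rule_format, of \<beta>] less_imp_le by blast
  have s: "\<beta> \<le> real s * \<alpha>" unfolding s_def by (rule LeastI_ex[OF ex])
  then have s0: "0 < s" using assms(3) by (cases s) auto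
  then have s1: "real (s - 1) * \<alpha> < \<beta>"
    using not_less_Least[of "s - 1" "\<lambda>s. \<beta> \<le> real s * \<alpha>"] by (simp add: s_def[symmetric])
  obtain d where "\<alpha> ^ d < \<beta> / (2 * (real s + 2))"
    using real_arch_pow_inv[of "\<beta> / (2 * (real s + 2))" \<alpha>] assms by auto
  moreover have "\<alpha> ^ Suc d \<le> \<alpha> ^ d" using assms by (intro power_decreasing) auto
  ultimately have "\<alpha> ^ Suc d < \<beta> / (2 * (real s + 2))" by linarith
  then have d: "2 * (real s + 2) * \<alpha> ^ Suc d < \<beta>" by (simp add: field_simps)
  \<comment> \<open>The path carries \<open>t + 1\<close> blocks rather than \<open>t\<close>: the
    lower bound loses one leaf, and \<open>(l - 1) + (s - 1) + (t + 1)\<close> exceeds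
    \<open>l + (s - 1)\<close> by exactly \<open>t\<close>.\<close>
  define k where "k = 1 + (t + 1) * (2 * d + 1)"
  have k: "0 < k" by (simp add: k_def)
  obtain l where "1 < real l * \<alpha> ^ Suc k"
    using reals_Archimedean3[of "\<alpha> ^ Suc k"] assms(1) by auto
  then have l: "1 \<le> real l * \<alpha> ^ Suc k" "0 < l" by (auto intro!: gr0I)
  have "(l - 1) + (s - 1) + (t + 1) \<le> tzf_number \<alpha> \<beta> (Gslk s l k)"
    by (rule tzf_number_Gslk_ge[OF assms(1-3) s d k_def k])
  moreover have "tzf_number \<alpha> \<beta> (contract (Gslk s l k) x_vertex (Pend s)) \<le> l + (s - 1)"
    unfolding contract_Gslk[OF k s0] by (rule tzf_number_Gslk_le[OF assms(1-4) s1 k l(1)])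
  ultimately have "int (tzf_number \<alpha> \<beta> (Gslk s l k)) - int (tzf_number \<alpha> \<beta> (contract (Gslk s l k) x_vertex (Pend s))) \<ge> int t"
    using l(2) by linarith
  then show ?thesis using k l(2) s0 by blast
qed

end
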